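(* Let $D$ be an integral domain and let $\Phi_a:\mathrm{SStar}(D)\to\mathrm{SStar}_{f,eab}(D)$ be the map defined by $\Phi_a(\star):=\star_a$ for each $\star\in\mathrm{SStar}(D)$. Then $\Phi_a$ is a topological retraction of $\mathrm{SStar}(D)$ onto $\mathrm{SStar}_{f,eab}(D)$ (both with the Zariski topology).
   Context: Let $K$ be the quotient field of $D$, $\overline{\mathbf F}(D)$ the set of nonzero $D$-submodules of $K$, $\mathbf f(D)$ the set of nonzero finitely generated fractional ideals of $D$; for $D$-submodules $A,B$ of $K$, $(A:B):=\{x\in K\mid xB\subseteq A\}$. A semistar operation on $D$ is a map $\star:\overline{\mathbf F}(D)\to\overline{\mathbf F}(D)$, $E\mapsto E^\star$, such that for all $0\ne z\in K$ and $E,F\in\overline{\mathbf F}(D)$: $(zE)^\star=zE^\star$; $E\subseteq F\Rightarrow E^\star\subseteq F^\star$; $E\subseteq E^\star$; $(E^\star)^\star=E^\star$. $\mathrm{SStar}(D)$ is the set of all semistar operations on $D$; its Zariski topology has as subbasis of open sets the sets $V_E:=\{\star\in\mathrm{SStar}(D)\mid 1\in E^\star\}$, $E\in\overline{\mathbf F}(D)$; subsets carry the subspace topology. $\star$ is of finite type if $E^\star=\bigcup\{F^\star\mid F\subseteq E,F\in\mathbf f(D)\}$ for all $E\in\overline{\mathbf F}(D)$. $\star$ is eab if for all $F,G,H\in\mathbf f(D)$, $(FG)^\star\subseteq(FH)^\star$ implies $G^\star\subseteq H^\star$. $\mathrm{SStar}_{f,eab}(D)$ is the set of eab semistar operations of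 finite type. For $\star\in\mathrm{SStar}(D)$, $\star_a$ is defined by $F^{\star_a}:=\bigcup\{((FG)^\star:G^\star)\mid G\in\mathbf f(D)\}$ for $F\in\mathbf f(D)$ and $E^{\star_a}:=\bigcup\{F^{\star_a}\mid F\subseteq E,F\in\mathbf f(D)\}$ for $E\in\overline{\mathbf F}(D)$; it is known that $\star_a\in\mathrm{SStar}_{f,eab}(D)$. A topological retraction of a space $X$ onto a subspace $A$ is a continuous map $X\to A$ restricting to the identity on $A$. *)

theory Defs
  imports "HOL-Analysis.Abstract_Topology_2" "HOL-Analysis.Function_Topology"
    "HOL-Computational_Algebra.Polynomial_Factorial"
begin

text \<open>
  The integral domain \<open>D\<close> is a type \<open>'a :: idom\<close>, and its quotient field \<open>K\<close> is the type
  \<open>'a fract\<close>; inside \<open>K\<close>, the domain \<open>D\<close> is the set \<open>range to_fract\<close>.  Subspaces and spans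
  with respect to the following scalar multiplication are \<open>D\<close>-submodules of \<open>K\<close> and
  \<open>D\<close>-submodules generated by a set.
\<close>

global_interpretation D: module "\<lambda>(d :: 'a :: idom) (x :: 'a fract). to_fract d * x"
  by standard (simp_all add: algebra_simps)

definition submodules :: "'a :: idom fract set set" where
  "submodules = {E. D.subspace E \<and> E \<noteq> {0}}"

definition fractional_ideal :: "'a :: idom fract set \<Rightarrow> bool" where
  "fractional_ideal E \<longleftrightarrow>
     D.subspace E \<and> (\<exists>d. d \<noteq> 0 \<and> (\<lambda>x. to_fract d * x) ` E \<subseteq> range to_fract)"

definition fg_ideals :: "'a :: idom fract set set" where
  "fg_ideals = {F. fractional_ideal F \<and> F \<noteq> {0} \<and> (\<exists>S. finite S \<and> F = D.span S)}"

definition mod_prod :: "'a :: idom fract set \<Rightarrow> 'a fract set \<Rightarrow> 'a fract set" where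
  "mod_prod F G = D.span {x * y |x y. x \<in> F \<and> y \<in> G}"

definition colon :: "'a :: idom fract set \<Rightarrow> 'a fract set \<Rightarrow> 'a fract set" where
  "colon A B = {x. (\<lambda>b. x * b) ` B \<subseteq> A}"

text \<open>
  A map on the nonzero submodules is a function that is \<open>undefined\<close> on all other sets, so that
  equality of semistar operations is equality of functions.
\<close>

definition SStar :: "('a :: idom fract set \<Rightarrow> 'a fract set) set" where
  "SStar = {star \<in> submodules \<rightarrow>\<^sub>E submodules.
     (\<forall>z E. z \<noteq> 0 \<longrightarrow> E \<in> submodules \<longrightarrow> star ((\<lambda>x. z * x) ` E) = (\<lambda>x. z * x) ` star E) \<and>
     (\<forall>E\<in>submodules. \<forall>F\<in>submodules. E \<subseteq> F \<longrightarrow> star E \<subseteq> star F) \<and>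
     (\<forall>E\<in>submodules. E \<subseteq> star E) \<and>
     (\<forall>E\<in>submodules. star (star E) = star E)}"

definition SStar_zariski :: "('a :: idom fract set \<Rightarrow> 'a fract set) topology" where
  "SStar_zariski = topology_generated_by {{star \<in> SStar. 1 \<in> star E} |E. E \<in> submodules}"

definition finite_type :: "('a :: idom fract set \<Rightarrow> 'a fract set) \<Rightarrow> bool" where
  "finite_type star \<longleftrightarrow> (\<forall>E\<in>submodules. star E = \<Union>{star F |F. F \<subseteq> E \<and> F \<in> fg_ideals})"

definition eab :: "('a :: idom fract set \<Rightarrow> 'a fract set) \<Rightarrow> bool" where
  "eab star \<longleftrightarrow> (\<forall>F\<in>fg_ideals. \<forall>G\<in>fg_ideals. \<forall>H\<in>fg_ideals.
     star (mod_prod F G) \<subseteq> star (mod_prod F H) \<longrightarrow> star G \<subseteq> star H)"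

definition SStar_f_eab :: "('a :: idom fract set \<Rightarrow> 'a fract set) set" where
  "SStar_f_eab = {star \<in> SStar. finite_type star \<and> eab star}"

definition star_a_fg ::
  "('a :: idom fract set \<Rightarrow> 'a fract set) \<Rightarrow> 'a fract set \<Rightarrow> 'a fract set" where
  "star_a_fg star F = \<Union>{colon (star (mod_prod F G)) (star G) |G. G \<in> fg_ideals}"

text \<open>
  On finitely generated fractional ideals \<open>Phi_a star\<close> agrees with \<open>star_a_fg star\<close>; see
  \<open>Phi_a_fg\<close> below.
\<close>

definition Phi_a ::
  "('a :: idom fract set \<Rightarrow> 'a fract set) \<Rightarrow> 'a fract set \<Rightarrow> 'a fract set" where
  "Phi_a star = (\<lambda>E\<in>submodules. \<Union>{star_a_fg star F |F. F \<subseteq> E \<and> F \<in> fg_ideals})"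

lemma fg_ideals_subset_submodules: "fg_ideals \<subseteq> submodules"
  by (auto simp: fg_ideals_def fractional_ideal_def submodules_def)

lemma mod_prod_mono: "F \<subseteq> F' \<Longrightarrow> mod_prod F G \<subseteq> mod_prod F' G"
  unfolding mod_prod_def by (rule D.span_mono) auto

lemma submodules_nonzero: "E \<in> submodules \<Longrightarrow> \<exists>x\<in>E. x \<noteq> 0"
  using D.subspace_0 by (fastforce simp: submodules_def)

lemma mod_prod_submodules:
  assumes "F \<in> submodules" "G \<in> submodules"
  shows "mod_prod F G \<in> submodules"
proof -
  obtain x y where "x \<in> F" "y \<in> G" "x \<noteq> 0" "y \<noteq> 0"
    using assms submodules_nonzero by meson
  then have "x * y \<in> mod_prod F G" "x * y \<noteq> 0"
    unfolding mod_prod_def by (blast intro: D.span_base, simp)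
  then have "mod_prod F G \<noteq> {0}"
    by blast
  moreover have "D.subspace (mod_prod F G)"
    unfolding mod_prod_def by (rule D.subspace_span)
  ultimately show ?thesis
    unfolding submodules_def by blast
qed

lemma Phi_a_fg:
  assumes "star \<in> SStar" "F \<in> fg_ideals"
  shows "Phi_a star F = star_a_fg star F"
proof -
  have "star_a_fg star F' \<subseteq> star_a_fg star F" if "F' \<subseteq> F" "F' \<in> fg_ideals" for F'
  proof -
    have "star (mod_prod F' G) \<subseteq> star (mod_prod F G)" if "G \<in> fg_ideals" for G
    proof -
      have "mod_prod F' G \<in> submodules" "mod_prod F G \<in> submodules"
        using assms(2) \<open>F' \<in> fg_ideals\<close> that fg_ideals_subset_submodules
        by (meson mod_prod_submodules subsetD)+
      then show ?thesis
        using assms(1) mod_prod_mono[OF \<open>F' \<subseteq> F\<close>, of G] by (simp add: SStar_def)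
    qed
    then show ?thesis
      unfolding star_a_fg_def colon_def by blast
  qed
  then show ?thesis
    using assms fg_ideals_subset_submodules by (auto simp: Phi_a_def)
qed

lemma fractional_ideal_span:
  assumes "finite S"
  shows "fractional_ideal (D.span S)"
proof -
  have "\<exists>d. d \<noteq> 0 \<and> (\<forall>x\<in>S. to_fract d * x \<in> range to_fract)"
    using assms
  proof induction
    case (insert x S)
    then obtain d where d: "d \<noteq> 0" "\<And>y. y \<in> S \<Longrightarrow> to_fract d * y \<in> range to_fract" by blast
    obtain a b where x: "x = Fract a b" "b \<noteq> 0" by (cases x) auto
    have "to_fract (b * d) * x = to_fract (a * d)"
      using x by (simp add: to_fract_def eq_fract)
    moreover have "to_fract (b * d) * y \<in> range to_fract" if y: "y \<in> S" for y
    proof -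
      obtain c where "to_fract d * y = to_fract c" using d(2)[OF y] by blast
      then have "to_fract (b * d) * y = to_fract (b * c)" by (simp add: mult.assoc)
      then show ?thesis by blast
    qed
    moreover have "b * d \<noteq> 0" using d(1) x(2) by simp
    ultimately show ?case by (metis insert_iff rangeI)
  next
    case empty
    show ?case by (rule exI[of _ 1]) simp
  qed
  then obtain d where d: "d \<noteq> 0" "\<And>y. y \<in> S \<Longrightarrow> to_fract d * y \<in> range to_fract" by blast
  have "D.subspace {y. to_fract d * y \<in> range to_fract}"
  proof (rule D.subspaceI; clarify)
    show "to_fract d * 0 \<in> range to_fract" by (metis mult_zero_right rangeI to_fract_0)
  next
    fix x y a b assume "to_fract d * x = to_fract a" "to_fract d * y = to_fract b"
    then show "to_fract d * (x + y) \<in> range to_fract"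
      by (metis distrib_left rangeI to_fract_add)
  next
    fix c x a assume "to_fract d * x = to_fract a"
    then have "to_fract d * (to_fract c * x) = to_fract (c * a)"
      by (simp add: mult.left_commute)
    then show "to_fract d * (to_fract c * x) \<in> range to_fract" by blast
  qed
  then have "D.span S \<subseteq> {y. to_fract d * y \<in> range to_fract}"
    using d by (intro D.span_minimal) auto
  then show ?thesis
    using d(1) D.subspace_span[of S] unfolding fractional_ideal_def by blast
qed

lemma topspace_SStar_zariski:
  "topspace SStar_zariski = (SStar :: ('a :: idom fract set \<Rightarrow> 'a fract set) set)" (is "?T = ?S")
proof
  show "?S \<subseteq> ?T"
  proof
    fix star :: "'a fract set \<Rightarrow> 'a fract set" assume star: "star \<in> SStar"
    have "(UNIV :: 'a fract set) \<noteq> {0}"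
      using zero_neq_one by (metis UNIV_I singletonD)
    then have "UNIV \<in> (submodules :: 'a fract set set)"
      using D.subspace_UNIV unfolding submodules_def by blast
    then have "UNIV \<subseteq> star UNIV" "UNIV \<in> (submodules :: 'a fract set set)"
      using star unfolding SStar_def by blast+
    then show "star \<in> topspace SStar_zariski"
      using star unfolding SStar_zariski_def topology_generated_by_topspace by blast
  qed
qed (auto simp: SStar_zariski_def topology_generated_by_topspace)

lemma topspace_SStar_f_eab: "topspace (subtopology SStar_zariski SStar_f_eab) = SStar_f_eab"
  by (auto simp: topspace_SStar_zariski SStar_f_eab_def)

end

theory Submission
  imports Defs
begin

text \<open>
  For a semistar operation \<open>\<star>\<close>, a scalar \<open>x\<close> carries the closure \<open>G\<^sup>\<star>\<close> into \<open>(FG)\<^sup>\<star>\<close> as soon as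
  it carries \<open>G\<close> itself there.  So \<open>x\<close> lies in the \<open>\<star>\<^sub>a\<close>-closure of a submodule \<open>E\<close> if and only
  if \<open>xG \<subseteq> (FG)\<^sup>\<star>\<close> for some finitely generated \<open>F \<subseteq> E\<close> and \<open>G\<close>; call such a pair a witness for
  \<open>x\<close> (\<open>in_Phi_a_iff\<close>).  A witness survives if \<open>F\<close> is enlarged and if \<open>G\<close> is multiplied by a
  further module (\<open>witness_enlarge\<close>); hence finitely many elements of the closure always have a
  common witness (\<open>common_witness\<close>).

  The common witness does all the algebraic work.  It shows that \<open>\<star>\<^sub>a\<close>-closures are submodules;
  that \<open>\<star>\<^sub>a\<close> is idempotent, since a common witness for generators of a finitely generated
  submodule of the closure can be multiplied into any witness above it; and that \<open>\<star>\<^sub>a\<close> is eab: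
  if \<open>FG\<close> is contained in the closure of \<open>FH\<close>, a common witness gives \<open>FGG' \<subseteq> (FHG')\<^sup>\<star>\<close>, and
  reading \<open>FG'\<close> as the second component turns this into witnesses over \<open>H\<close> for the elements of
  \<open>G\<close>.  If \<open>\<star>\<close> is already eab of finite type, then cancelling \<open>G\<close> from
  \<open>(xD)G \<subseteq> (FG)\<^sup>\<star>\<close> shows that \<open>\<star>\<^sub>a\<close> adds nothing to \<open>\<star>\<close>; it loses
  nothing either, because \<open>(F, D)\<close> is a witness for the elements of \<open>F\<^sup>\<star>\<close>.

  Continuity is a matter of finiteness.  That \<open>1\<close> lies in the \<open>\<star>\<^sub>a\<close>-closure of \<open>E\<close> says that
  \<open>G \<subseteq> (FG)\<^sup>\<star>\<close> for some finitely generated \<open>F \<subseteq> E\<close> and \<open>G\<close>.  For each pair this concerns only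
  finitely many generators \<open>g\<close> of \<open>G\<close>; and, for \<open>g \<noteq> 0\<close>, \<open>g \<in> (FG)\<^sup>\<star>\<close> is the subbasic
  condition \<open>1 \<in> (g\<^sup>-\<^sup>1FG)\<^sup>\<star>\<close>.  So the preimage of a subbasic open set is a union of finite
  intersections of subbasic open sets.
\<close>

section \<open>Products of submodules of the quotient field\<close>

lemma fg_ideals_iff: "F \<in> fg_ideals \<longleftrightarrow> F \<in> submodules \<and> (\<exists>S. finite S \<and> F = D.span S)"
  using fractional_ideal_span
  by (auto simp: fg_ideals_def submodules_def D.subspace_span)

lemma submodulesD: "E \<in> submodules \<Longrightarrow> D.subspace E"
  by (simp add: submodules_def)

lemma submodules_of_nonzero_element:
  "D.subspace E \<Longrightarrow> x \<in> E \<Longrightarrow> x \<noteq> 0 \<Longrightarrow> E \<in> submodules"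
  by (auto simp: submodules_def)

lemma fg_ideals_span: "finite S \<Longrightarrow> x \<in> S \<Longrightarrow> x \<noteq> 0 \<Longrightarrow> D.span S \<in> fg_ideals"
  unfolding fg_ideals_iff
  by (metis D.span_base D.subspace_span submodules_of_nonzero_element)

lemma subspace_preimage_mult: "D.subspace M \<Longrightarrow> D.subspace {x. x * z \<in> M}"
  by (rule D.subspaceI)
     (auto simp: D.subspace_0 D.subspace_add distrib_right mult.assoc D.subspace_scale)

lemma mod_prod_memI: "x \<in> F \<Longrightarrow> y \<in> G \<Longrightarrow> x * y \<in> mod_prod F G"
  unfolding mod_prod_def by (rule D.span_base) auto

lemma mod_prod_subset:
  "D.subspace M \<Longrightarrow> (\<And>x y. x \<in> F \<Longrightarrow> y \<in> G \<Longrightarrow> x * y \<in> M) \<Longrightarrow> mod_prod F G \<subseteq> M"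
  unfolding mod_prod_def by (rule D.span_minimal) auto

lemma subspace_mod_prod: "D.subspace (mod_prod F G)"
  unfolding mod_prod_def by (rule D.subspace_span)

lemma mod_prod_commute: "mod_prod F G = mod_prod G F"
  unfolding mod_prod_def by (rule arg_cong[where f = D.span]) (blast intro: mult.commute)

lemma mod_prod_assoc_subset: "mod_prod (mod_prod F G) H \<subseteq> mod_prod F (mod_prod G H)"
proof (rule mod_prod_subset[OF subspace_mod_prod])
  fix x z assume "x \<in> mod_prod F G" and z: "z \<in> H"
  moreover have "mod_prod F G \<subseteq> {x. x * z \<in> mod_prod F (mod_prod G H)}"
    using z by (intro mod_prod_subset subspace_preimage_mult subspace_mod_prod)
      (simp add: mult.assoc mod_prod_memI)
  ultimately show "x * z \<in> mod_prod F (mod_prod G H)"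
    by blast
qed

lemma mod_prod_assoc: "mod_prod (mod_prod F G) H = mod_prod F (mod_prod G H)"
proof
  show "mod_prod F (mod_prod G H) \<subseteq> mod_prod (mod_prod F G) H"
    using mod_prod_assoc_subset[of H G F] by (simp add: mod_prod_commute)
qed (rule mod_prod_assoc_subset)

lemma mod_prod_span: "mod_prod (D.span S) (D.span T) = D.span {x * y |x y. x \<in> S \<and> y \<in> T}"
proof
  let ?M = "D.span {x * y |x y. x \<in> S \<and> y \<in> T}"
  show "mod_prod (D.span S) (D.span T) \<subseteq> ?M"
  proof (rule mod_prod_subset[OF D.subspace_span])
    fix x y assume x: "x \<in> D.span S" and y: "y \<in> D.span T"
    have "D.span S \<subseteq> {x. x * t \<in> ?M}" if "t \<in> T" for t
      using that
      by (intro D.span_minimal subspace_preimage_mult D.subspace_span) (auto intro: D.span_base)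
    then have "D.span T \<subseteq> {y. y * x \<in> ?M}"
      using x by (intro D.span_minimal subspace_preimage_mult D.subspace_span)
        (auto simp: mult.commute)
    then show "x * y \<in> ?M"
      using y by (auto simp: mult.commute)
  qed
  show "?M \<subseteq> mod_prod (D.span S) (D.span T)"
    unfolding mod_prod_def by (rule D.span_mono) (auto intro: D.span_base)
qed

lemma fg_ideals_mod_prod:
  assumes "F \<in> fg_ideals" "G \<in> fg_ideals"
  shows "mod_prod F G \<in> fg_ideals"
proof -
  obtain S T where "finite S" "F = D.span S" "finite T" "G = D.span T"
    using assms by (auto simp: fg_ideals_iff)
  then have "finite {x * y |x y. x \<in> S \<and> y \<in> T}"
      "mod_prod F G = D.span {x * y |x y. x \<in> S \<and> y \<in> T}"
    by (auto simp: mod_prod_span finite_image_set2)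
  moreover have "mod_prod F G \<in> submodules"
    using assms by (auto simp: fg_ideals_iff mod_prod_submodules)
  ultimately show ?thesis
    unfolding fg_ideals_iff by blast
qed

lemma fg_ideals_span_Un:
  assumes "F \<in> fg_ideals" "G \<in> fg_ideals"
  shows "D.span (F \<union> G) \<in> fg_ideals"
proof -
  obtain S T where ST: "finite S" "F = D.span S" "finite T" "G = D.span T"
    using assms by (auto simp: fg_ideals_iff)
  have "D.span (F \<union> G) = D.span (S \<union> T)"
  proof
    have "D.span S \<subseteq> D.span (S \<union> T)" "D.span T \<subseteq> D.span (S \<union> T)"
      by (intro D.span_mono; simp)+
    then show "D.span (F \<union> G) \<subseteq> D.span (S \<union> T)"
      using ST by (intro D.span_minimal) auto
    show "D.span (S \<union> T) \<subseteq> D.span (F \<union> G)"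
      using ST by (intro D.span_mono) (auto intro: D.span_base)
  qed
  moreover obtain x where "x \<in> F" "x \<noteq> 0"
    using assms(1) submodules_nonzero by (auto simp: fg_ideals_iff)
  then have "D.span (F \<union> G) \<in> submodules"
    by (intro submodules_of_nonzero_element[of _ x]) (auto intro: D.span_base)
  ultimately show ?thesis
    using ST unfolding fg_ideals_iff by (metis finite_UnI)
qed

lemma mod_prod_principal:
  assumes "D.subspace E"
  shows "mod_prod (D.span {z}) E = (\<lambda>x. z * x) ` E"
proof
  have sub: "D.subspace ((\<lambda>x. z * x) ` E)"
  proof (rule D.subspaceI)
    show "0 \<in> (\<lambda>x. z * x) ` E"
      using D.subspace_0[OF assms] by (auto intro: image_eqI[of _ _ 0])
    show "x + y \<in> (\<lambda>x. z * x) ` E"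
      if "x \<in> (\<lambda>x. z * x) ` E" "y \<in> (\<lambda>x. z * x) ` E" for x y
      using that D.subspace_add[OF assms] by (auto simp flip: distrib_left)
    show "to_fract c * x \<in> (\<lambda>x. z * x) ` E" if "x \<in> (\<lambda>x. z * x) ` E" for c x
      using that D.subspace_scale[OF assms, of _ c]
      by (auto intro!: image_eqI[of _ _ "to_fract c * _"] simp: mult.left_commute)
  qed
  show "mod_prod (D.span {z}) E \<subseteq> (\<lambda>x. z * x) ` E"
  proof (rule mod_prod_subset[OF sub])
    fix x y assume "x \<in> D.span {z}" "y \<in> E"
    then obtain c where "x = to_fract c * z"
      by (auto simp: D.span_singleton)
    then have "x * y = z * (to_fract c * y)"
      by simp
    then show "x * y \<in> (\<lambda>x. z * x) ` E"
      using D.subspace_scale[OF assms \<open>y \<in> E\<close>] by blast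
  qed
  show "(\<lambda>x. z * x) ` E \<subseteq> mod_prod (D.span {z}) E"
    by (auto intro: mod_prod_memI D.span_base)
qed

lemma mod_prod_unit: "D.subspace E \<Longrightarrow> mod_prod E (D.span {1}) = E"
  using mod_prod_principal[of E 1] by (simp add: mod_prod_commute)

lemma fg_ideals_principal: "z \<noteq> 0 \<Longrightarrow> D.span {z} \<in> fg_ideals"
  using fg_ideals_span[of "{z}" z] by simp

lemma submodules_scale: "z \<noteq> 0 \<Longrightarrow> E \<in> submodules \<Longrightarrow> (\<lambda>x. z * x) ` E \<in> submodules"
  by (metis fg_ideals_iff fg_ideals_principal mod_prod_principal mod_prod_submodules submodulesD)

lemma fg_ideals_scale: "z \<noteq> 0 \<Longrightarrow> F \<in> fg_ideals \<Longrightarrow> (\<lambda>x. z * x) ` F \<in> fg_ideals"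
  by (metis fg_ideals_iff fg_ideals_mod_prod fg_ideals_principal mod_prod_principal submodulesD)

section \<open>Semistar operations\<close>

lemma SStarD:
  assumes "star \<in> SStar"
  shows SStar_scale: "\<And>z E. z \<noteq> 0 \<Longrightarrow> E \<in> submodules \<Longrightarrow>
            star ((\<lambda>x. z * x) ` E) = (\<lambda>x. z * x) ` star E"
    and SStar_mono: "\<And>E F. E \<in> submodules \<Longrightarrow> F \<in> submodules \<Longrightarrow> E \<subseteq> F \<Longrightarrow> star E \<subseteq> star F"
    and SStar_extensive: "\<And>E. E \<in> submodules \<Longrightarrow> E \<subseteq> star E"
    and SStar_idem: "\<And>E. E \<in> submodules \<Longrightarrow> star (star E) = star E"
    and SStar_submodules: "\<And>E. E \<in> submodules \<Longrightarrow> star E \<in> submodules"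
    and SStar_extensional: "star \<in> extensional submodules"
  using assms by (auto simp: SStar_def PiE_iff)

lemma SStar_subspace: "star \<in> SStar \<Longrightarrow> E \<in> submodules \<Longrightarrow> D.subspace (star E)"
  by (blast intro: SStar_submodules submodulesD)

lemma SStar_closure_subset:
  "star \<in> SStar \<Longrightarrow> E \<in> submodules \<Longrightarrow> F \<in> submodules \<Longrightarrow> E \<subseteq> star F \<Longrightarrow> star E \<subseteq> star F"
  by (metis SStar_idem SStar_mono SStar_submodules)

lemma mult_mem_star_mod_prod:
  assumes star: "star \<in> SStar" and E: "E \<in> submodules" and F: "F \<in> submodules"
    and x: "x \<in> star E" and y: "y \<in> F"
  shows "x * y \<in> star (mod_prod E F)"
proof (cases "y = 0")
  case True
  then show ?thesis
    using D.subspace_0 SStar_subspace[OF star mod_prod_submodules[OF E F]] by auto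
next
  case False
  have "(\<lambda>x. y * x) ` E \<subseteq> mod_prod E F"
    using y by (auto simp: mult.commute[of y] intro: mod_prod_memI)
  then have "star ((\<lambda>x. y * x) ` E) \<subseteq> star (mod_prod E F)"
    by (intro SStar_mono[OF star] submodules_scale mod_prod_submodules E F False)
  then show ?thesis
    using x by (auto simp: SStar_scale[OF star False E] mult.commute[of x])
qed

text \<open>
  Scaling reduces membership of any nonzero element to membership of \<open>1\<close>, the only element that
  the Zariski topology mentions.
\<close>

lemma mem_star_iff_one_mem:
  assumes "star \<in> SStar" "E \<in> submodules" "g \<noteq> 0"
  shows "g \<in> star E \<longleftrightarrow> 1 \<in> star ((\<lambda>x. inverse g * x) ` E)"
proof -
  have "1 \<in> (\<lambda>x. inverse g * x) ` star E \<longleftrightarrow> g \<in> star E"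
    using assms(3) by (auto simp: image_iff field_simps)
  then show ?thesis
    using assms by (simp add: SStar_scale)
qed

section \<open>Witnesses for membership in the closure\<close>

definition witness ::
  "('a :: idom fract set \<Rightarrow> 'a fract set) \<Rightarrow> 'a fract set \<Rightarrow> 'a fract set \<Rightarrow> 'a fract \<Rightarrow> bool" where
  "witness star F G x \<longleftrightarrow> (\<forall>g\<in>G. x * g \<in> star (mod_prod F G))"

text \<open>
  For \<open>x \<noteq> 0\<close>, \<open>xG\<^sup>\<star> = (xG)\<^sup>\<star>\<close>, and this lies in the closed module \<open>(FG)\<^sup>\<star>\<close> as soon as \<open>xG\<close>
  does.  The condition that remains is linear in \<open>x\<close> and in the elements of \<open>G\<close>, so it can be
  checked on generators.
\<close>

lemma witness_iff_colon:
  assumes star: "star \<in> SStar" and F: "F \<in> submodules" and G: "G \<in> submodules"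
  shows "x \<in> colon (star (mod_prod F G)) (star G) \<longleftrightarrow> witness star F G x"
proof
  show "witness star F G x" if "x \<in> colon (star (mod_prod F G)) (star G)"
    using that SStar_extensive[OF star G] by (auto simp: colon_def witness_def)
next
  assume wit: "witness star F G x"
  have FG: "mod_prod F G \<in> submodules"
    by (rule mod_prod_submodules[OF F G])
  have "(\<lambda>b. x * b) ` star G \<subseteq> star (mod_prod F G)"
  proof (cases "x = 0")
    case True
    then show ?thesis
      using D.subspace_0[OF SStar_subspace[OF star FG]] by auto
  next
    case False
    have "(\<lambda>b. x * b) ` G \<subseteq> star (mod_prod F G)"
      using wit by (auto simp: witness_def)
    then have "star ((\<lambda>b. x * b) ` G) \<subseteq> star (mod_prod F G)"
      by (intro SStar_closure_subset[OF star] submodules_scale False G FG)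
    then show ?thesis
      by (simp add: SStar_scale[OF star False G])
  qed
  then show "x \<in> colon (star (mod_prod F G)) (star G)"
    by (simp add: colon_def)
qed

lemma in_Phi_a_iff:
  assumes star: "star \<in> SStar" and E: "E \<in> submodules"
  shows "x \<in> Phi_a star E \<longleftrightarrow>
    (\<exists>F\<in>fg_ideals. \<exists>G\<in>fg_ideals. F \<subseteq> E \<and> witness star F G x)"
proof -
  have "x \<in> star_a_fg star F \<longleftrightarrow> (\<exists>G\<in>fg_ideals. witness star F G x)"
    if "F \<in> fg_ideals" for F
    using that witness_iff_colon[OF star, of F] fg_ideals_subset_submodules
    unfolding star_a_fg_def by blast
  then show ?thesis
    using E by (auto simp: Phi_a_def)
qed

lemma subspace_witness:
  assumes "star \<in> SStar" "F \<in> submodules" "G \<in> submodules"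
  shows "D.subspace {x. witness star F G x}"
proof -
  have "D.subspace (star (mod_prod F G))"
    by (intro SStar_subspace mod_prod_submodules assms)
  then have "D.subspace (\<Inter>g\<in>G. {x. x * g \<in> star (mod_prod F G)})"
    by (intro D.subspace_Inter) (auto intro: subspace_preimage_mult)
  moreover have "{x. witness star F G x} = (\<Inter>g\<in>G. {x. x * g \<in> star (mod_prod F G)})"
    by (auto simp: witness_def)
  ultimately show ?thesis
    by simp
qed

text \<open>
  From \<open>xG \<subseteq> (FG)\<^sup>\<star>\<close> follows \<open>xGH \<subseteq> (FG)\<^sup>\<star>H \<subseteq> (FGH)\<^sup>\<star> \<subseteq> (F'GH)\<^sup>\<star>\<close>.
\<close>

lemma witness_enlarge:
  assumes star: "star \<in> SStar"
    and sub: "F \<in> submodules" "F' \<in> submodules" "G \<in> submodules" "H \<in> submodules"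
    and FF': "F \<subseteq> F'" and wit: "witness star F G x"
  shows "witness star F' (mod_prod G H) x"
proof -
  have GH: "mod_prod G H \<in> submodules"
    by (intro mod_prod_submodules sub)
  let ?M = "star (mod_prod F' (mod_prod G H))"
  have "D.subspace ?M"
    by (intro SStar_subspace[OF star] mod_prod_submodules sub GH)
  moreover have "star (mod_prod F (mod_prod G H)) \<subseteq> ?M"
    by (intro SStar_mono[OF star] mod_prod_submodules sub GH mod_prod_mono FF')
  then have "(x * g) * h \<in> ?M" if "g \<in> G" "h \<in> H" for g h
    using wit that
      mult_mem_star_mod_prod[OF star mod_prod_submodules[OF sub(1,3)] sub(4), of "x * g" h]
    by (auto simp: witness_def mod_prod_assoc)
  ultimately have "mod_prod G H \<subseteq> {k. k * x \<in> ?M}"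
    by (intro mod_prod_subset subspace_preimage_mult) (simp_all add: ac_simps)
  then show ?thesis
    by (auto simp: witness_def mult.commute)
qed

lemma witness_of_mem:
  assumes "star \<in> SStar" "F \<in> submodules" "x \<in> star F"
  shows "witness star F (D.span {1}) x"
proof -
  have "D.subspace (star F)"
    using assms by (intro SStar_subspace)
  then show ?thesis
    using assms D.subspace_scale[of "star F" x]
    unfolding witness_def mod_prod_unit[OF submodulesD[OF assms(2)]]
    by (auto simp: D.span_singleton mult.commute[of x])
qed

text \<open>
  Two witnesses \<open>(F, G)\<close> and \<open>(F', G')\<close> are both enlarged to \<open>(F + F', GG')\<close>.
\<close>

lemma common_witness:
  assumes star: "star \<in> SStar" and E: "E \<in> submodules"
    and "finite S" "S \<subseteq> Phi_a star E"
  shows "\<exists>F\<in>fg_ideals. \<exists>G\<in>fg_ideals. F \<subseteq> E \<and> (\<forall>x\<in>D.span S. witness star F G x)"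
proof -
  have "\<exists>F\<in>fg_ideals. \<exists>G\<in>fg_ideals. F \<subseteq> E \<and> (\<forall>x\<in>S. witness star F G x)"
    using assms(3,4)
  proof induction
    case empty
    obtain x where x: "x \<in> E" "x \<noteq> 0"
      using submodules_nonzero[OF E] by blast
    then have "D.span {x} \<in> fg_ideals" "D.span {x} \<subseteq> E"
      using D.span_minimal[of "{x}" E] submodulesD[OF E] by (auto intro: fg_ideals_principal)
    then show ?case
      by blast
  next
    case (insert y S)
    then obtain F G where FG: "F \<in> fg_ideals" "G \<in> fg_ideals" "F \<subseteq> E" "\<forall>x\<in>S. witness star F G x"
      by blast
    obtain F' G' where FG': "F' \<in> fg_ideals" "G' \<in> fg_ideals" "F' \<subseteq> E" "witness star F' G' y"
      using insert.prems in_Phi_a_iff[OF star E] by blast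
    let ?F = "D.span (F \<union> F')"
    have F: "?F \<in> fg_ideals" "F \<subseteq> ?F" "F' \<subseteq> ?F"
      using FG FG' by (auto intro: fg_ideals_span_Un D.span_base)
    have sub: "F \<in> submodules" "F' \<in> submodules" "G \<in> submodules" "G' \<in> submodules" "?F \<in> submodules"
      using FG FG' F fg_ideals_subset_submodules by blast+
    have "witness star ?F (mod_prod G G') x" if "x \<in> S" for x
      using FG(4) that F by (intro witness_enlarge[OF star, of F]) (simp_all add: sub)
    moreover have "witness star ?F (mod_prod G' G) y"
      using FG'(4) F by (intro witness_enlarge[OF star, of F']) (simp_all add: sub)
    moreover have "?F \<subseteq> E"
      using FG(3) FG'(3) by (intro D.span_minimal submodulesD E) simp
    ultimately show ?case
      using F(1) fg_ideals_mod_prod[OF FG(2) FG'(2)] mod_prod_commute[of G' G] by auto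
  qed
  then obtain F G where FG: "F \<in> fg_ideals" "G \<in> fg_ideals" "F \<subseteq> E" "S \<subseteq> {x. witness star F G x}"
    by blast
  moreover have "D.span S \<subseteq> {x. witness star F G x}"
    using FG fg_ideals_subset_submodules by (intro D.span_minimal subspace_witness star) auto
  ultimately show ?thesis
    by blast
qed

lemma common_witness_fg:
  assumes "star \<in> SStar" "E \<in> submodules" "L \<in> fg_ideals" "L \<subseteq> Phi_a star E"
  shows "\<exists>F\<in>fg_ideals. \<exists>G\<in>fg_ideals. F \<subseteq> E \<and> (\<forall>x\<in>L. witness star F G x)"
proof -
  obtain S where "finite S" "L = D.span S"
    using assms(3) by (auto simp: fg_ideals_iff)
  then show ?thesis
    using common_witness[OF assms(1,2), of S] assms(4) by (auto intro: D.span_base)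
qed

section \<open>The closure is a semistar operation of finite type, and eab\<close>

lemma Phi_a_mono:
  assumes "star \<in> SStar" "E \<in> submodules" "F \<in> submodules" "E \<subseteq> F"
  shows "Phi_a star E \<subseteq> Phi_a star F"
  using in_Phi_a_iff[OF assms(1)] assms(2-4) by (meson subset_iff)

lemma Phi_a_extensive:
  assumes star: "star \<in> SStar" and E: "E \<in> submodules"
  shows "E \<subseteq> Phi_a star E"
proof
  fix x assume x: "x \<in> E"
  show "x \<in> Phi_a star E"
  proof (cases "x = 0")
    case True
    \<comment> \<open>The submodule \<open>xD\<close> used below is zero here, so it cannot be part of a witness; but
      every common witness for the empty set is one for its span \<open>{0}\<close>.\<close>
    then show ?thesis
      using common_witness[OF star E, of "{}"] by (auto simp: in_Phi_a_iff[OF star E])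
  next
    case False
    then have fg: "D.span {x} \<in> fg_ideals"
      by (rule fg_ideals_principal)
    then have sub: "D.span {x} \<in> submodules"
      using fg_ideals_subset_submodules by blast
    have "x \<in> star (D.span {x})"
      using SStar_extensive[OF star sub] by (auto intro: D.span_base)
    then have "witness star (D.span {x}) (D.span {1}) x"
      by (rule witness_of_mem[OF star sub])
    moreover have "D.span {x} \<subseteq> E"
      using x by (intro D.span_minimal submodulesD E) simp
    ultimately show ?thesis
      using fg fg_ideals_principal[of 1] by (auto simp: in_Phi_a_iff[OF star E])
  qed
qed

lemma Phi_a_submodules:
  assumes star: "star \<in> SStar" and E: "E \<in> submodules"
  shows "Phi_a star E \<in> submodules"
proof -
  have span: "D.span S \<subseteq> Phi_a star E" if "finite S" "S \<subseteq> Phi_a star E" for S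
    using common_witness[OF star E that] in_Phi_a_iff[OF star E] by blast
  have "D.subspace (Phi_a star E)"
  proof (rule D.subspaceI)
    show "0 \<in> Phi_a star E"
      using span[of "{}"] by simp
    show "x + y \<in> Phi_a star E" if "x \<in> Phi_a star E" "y \<in> Phi_a star E" for x y
      using span[of "{x, y}"] that D.span_add[of x "{x, y}" y] by (auto intro: D.span_base)
    show "to_fract c * x \<in> Phi_a star E" if "x \<in> Phi_a star E" for c x
      using span[of "{x}"] that by (auto simp: D.span_singleton)
  qed
  moreover obtain x where "x \<in> E" "x \<noteq> 0"
    using submodules_nonzero[OF E] by blast
  ultimately show ?thesis
    using submodules_of_nonzero_element[of _ x] Phi_a_extensive[OF star E] by blast
qed

lemma Phi_a_scale_subset:
  assumes star: "star \<in> SStar" and E: "E \<in> submodules" and z: "z \<noteq> 0"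
  shows "(\<lambda>x. z * x) ` Phi_a star E \<subseteq> Phi_a star ((\<lambda>x. z * x) ` E)"
proof clarify
  fix x assume "x \<in> Phi_a star E"
  then obtain F G where FG: "F \<in> fg_ideals" "G \<in> fg_ideals" "F \<subseteq> E" "witness star F G x"
    by (auto simp: in_Phi_a_iff[OF star E])
  then have sub: "F \<in> submodules" "G \<in> submodules" "mod_prod F G \<in> submodules"
    using fg_ideals_subset_submodules by (auto intro: mod_prod_submodules)
  have "mod_prod ((\<lambda>x. z * x) ` F) G = (\<lambda>x. z * x) ` mod_prod F G"
    using mod_prod_assoc[of "D.span {z}" F G]
    by (simp only: mod_prod_principal submodulesD sub subspace_mod_prod)
  then have "witness star ((\<lambda>x. z * x) ` F) G (z * x)"
    using FG(4) by (auto simp: witness_def SStar_scale[OF star z sub(3)] mult.assoc)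
  then show "z * x \<in> Phi_a star ((\<lambda>x. z * x) ` E)"
    using FG fg_ideals_scale[OF z]
    unfolding in_Phi_a_iff[OF star submodules_scale[OF z E]] by (blast intro: image_mono)
qed

lemma Phi_a_scale:
  assumes star: "star \<in> SStar" and E: "E \<in> submodules" and z: "z \<noteq> 0"
  shows "Phi_a star ((\<lambda>x. z * x) ` E) = (\<lambda>x. z * x) ` Phi_a star E"
proof
  have "(\<lambda>x. inverse z * x) ` Phi_a star ((\<lambda>x. z * x) ` E) \<subseteq> Phi_a star E"
    using Phi_a_scale_subset[OF star submodules_scale[OF z E], of "inverse z"] z
    by (simp add: image_image mult.assoc[symmetric])
  then have "(\<lambda>x. z * x) ` (\<lambda>x. inverse z * x) ` Phi_a star ((\<lambda>x. z * x) ` E)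
      \<subseteq> (\<lambda>x. z * x) ` Phi_a star E"
    by (rule image_mono)
  then show "Phi_a star ((\<lambda>x. z * x) ` E) \<subseteq> (\<lambda>x. z * x) ` Phi_a star E"
    using z by (simp add: image_image mult.assoc[symmetric])
qed (rule Phi_a_scale_subset[OF assms])

lemma Phi_a_idem:
  assumes star: "star \<in> SStar" and E: "E \<in> submodules"
  shows "Phi_a star (Phi_a star E) = Phi_a star E"
proof
  show "Phi_a star (Phi_a star E) \<subseteq> Phi_a star E"
  proof
    fix x assume "x \<in> Phi_a star (Phi_a star E)"
    then obtain L G where LG: "L \<in> fg_ideals" "G \<in> fg_ideals" "L \<subseteq> Phi_a star E" "witness star L G x"
      by (auto simp: in_Phi_a_iff[OF star Phi_a_submodules[OF star E]])
    obtain F G' where FG': "F \<in> fg_ideals" "G' \<in> fg_ideals" "F \<subseteq> E" "\<forall>y\<in>L. witness star F G' y"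
      using common_witness_fg[OF star E LG(1,3)] by blast
    have sub: "L \<in> submodules" "G \<in> submodules" "F \<in> submodules" "G' \<in> submodules"
      using LG FG' fg_ideals_subset_submodules by blast+
    let ?K = "mod_prod G' G"
    have K: "?K \<in> submodules"
      by (intro mod_prod_submodules sub)
    \<comment> \<open>Both witnesses are brought to the same second component \<open>K = GG'\<close>; then
      \<open>xK \<subseteq> (LK)\<^sup>\<star>\<close> and \<open>LK \<subseteq> (FK)\<^sup>\<star>\<close> compose.\<close>
    have "\<forall>y\<in>L. witness star F ?K y"
      using FG'(4) by (auto intro: witness_enlarge[OF star, of F] sub)
    then have "mod_prod L ?K \<subseteq> star (mod_prod F ?K)"
      by (intro mod_prod_subset SStar_subspace[OF star] mod_prod_submodules sub K)
        (auto simp: witness_def)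
    then have "star (mod_prod L ?K) \<subseteq> star (mod_prod F ?K)"
      by (intro SStar_closure_subset[OF star] mod_prod_submodules sub K)
    moreover have "witness star L ?K x"
      using witness_enlarge[OF star sub(1) sub(1) sub(2) sub(4) _ LG(4)] mod_prod_commute[of G G']
      by simp
    ultimately have "witness star F ?K x"
      by (auto simp: witness_def)
    then show "x \<in> Phi_a star E"
      using FG' fg_ideals_mod_prod[OF FG'(2) LG(2)] by (auto simp: in_Phi_a_iff[OF star E])
  qed
qed (intro Phi_a_extensive Phi_a_submodules assms)

lemma Phi_a_in_SStar:
  assumes "star \<in> SStar"
  shows "Phi_a star \<in> SStar"
proof -
  have "Phi_a star \<in> submodules \<rightarrow>\<^sub>E submodules"
    using Phi_a_submodules[OF assms] by (auto simp: PiE_iff) (auto simp: Phi_a_def)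
  then show ?thesis
    using Phi_a_scale[OF assms] Phi_a_mono[OF assms] Phi_a_extensive[OF assms] Phi_a_idem[OF assms]
    by (auto simp: SStar_def)
qed

lemma finite_type_Phi_a:
  assumes "star \<in> SStar"
  shows "finite_type (Phi_a star)"
  unfolding finite_type_def
proof
  fix E :: "'a fract set" assume "E \<in> submodules"
  then have "Phi_a star E = \<Union>{star_a_fg star F |F. F \<subseteq> E \<and> F \<in> fg_ideals}"
    by (simp add: Phi_a_def)
  also have "{star_a_fg star F |F. F \<subseteq> E \<and> F \<in> fg_ideals}
      = {Phi_a star F |F. F \<subseteq> E \<and> F \<in> fg_ideals}"
    using Phi_a_fg[OF assms] by metis
  finally show "Phi_a star E = \<Union>{Phi_a star F |F. F \<subseteq> E \<and> F \<in> fg_ideals}" .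
qed

text \<open>
  A common witness \<open>(L, K)\<close> for \<open>FG\<close>, with \<open>L \<subseteq> FH\<close>, gives \<open>FGK \<subseteq> (LK)\<^sup>\<star> \<subseteq> (FHK)\<^sup>\<star>\<close>.  Regrouped
  as \<open>G(FK) \<subseteq> (H(FK))\<^sup>\<star>\<close>, this says that \<open>(H, FK)\<close> is a witness for every element of \<open>G\<close>.
\<close>

lemma eab_Phi_a:
  assumes star: "star \<in> SStar"
  shows "eab (Phi_a star)"
  unfolding eab_def
proof (intro ballI impI)
  fix F G H :: "'a fract set"
  assume fg: "F \<in> fg_ideals" "G \<in> fg_ideals" "H \<in> fg_ideals"
    and le: "Phi_a star (mod_prod F G) \<subseteq> Phi_a star (mod_prod F H)"
  have sub: "F \<in> submodules" "G \<in> submodules" "H \<in> submodules"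
    using fg fg_ideals_subset_submodules by blast+
  have FG: "mod_prod F G \<in> submodules" and FH: "mod_prod F H \<in> submodules"
    by (intro mod_prod_submodules sub)+
  have "mod_prod F G \<subseteq> Phi_a star (mod_prod F H)"
    using Phi_a_extensive[OF star FG] le by blast
  then obtain L K where LK: "L \<in> fg_ideals" "K \<in> fg_ideals" "L \<subseteq> mod_prod F H"
      "\<forall>x\<in>mod_prod F G. witness star L K x"
    using common_witness_fg[OF star FH fg_ideals_mod_prod[OF fg(1,2)]] by blast
  have K: "K \<in> submodules" and L: "L \<in> submodules"
    using LK fg_ideals_subset_submodules by blast+
  have FK: "mod_prod F K \<in> submodules"
    by (intro mod_prod_submodules sub K)
  have "star (mod_prod L K) \<subseteq> star (mod_prod (mod_prod F H) K)"
    by (intro SStar_mono[OF star] mod_prod_submodules sub K L mod_prod_mono LK)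
  moreover have "mod_prod (mod_prod F H) K = mod_prod H (mod_prod F K)"
    by (simp add: mod_prod_assoc mod_prod_commute[of F H])
  ultimately have le': "star (mod_prod L K) \<subseteq> star (mod_prod H (mod_prod F K))"
    by simp
  have "witness star H (mod_prod F K) g" if g: "g \<in> G" for g
  proof -
    have "mod_prod F K \<subseteq> {y. y * g \<in> star (mod_prod H (mod_prod F K))}"
    proof (intro mod_prod_subset subspace_preimage_mult SStar_subspace[OF star]
        mod_prod_submodules sub K CollectI)
      fix f k assume "f \<in> F" "k \<in> K"
      then have "(f * g) * k \<in> star (mod_prod L K)"
        using LK(4) g mod_prod_memI[of f F g G] by (auto simp: witness_def)
      then show "f * k * g \<in> star (mod_prod H (mod_prod F K))"
        using le' by (auto simp: ac_simps)
    qed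
    then show ?thesis
      by (auto simp: witness_def mult.commute)
  qed
  then have "G \<subseteq> Phi_a star H"
    using fg fg_ideals_mod_prod[OF fg(1) LK(2)] in_Phi_a_iff[OF star sub(3)] by blast
  then show "Phi_a star G \<subseteq> Phi_a star H"
    using SStar_closure_subset[OF Phi_a_in_SStar[OF star] sub(2,3)] by blast
qed

section \<open>The map fixes eab operations of finite type\<close>

text \<open>
  A witness says \<open>G(xD) \<subseteq> (GF)\<^sup>\<star>\<close>, and the eab property cancels \<open>G\<close>, leaving \<open>x \<in> F\<^sup>\<star>\<close>.
  Conversely an element of \<open>E\<^sup>\<star>\<close> lies in \<open>F\<^sup>\<star>\<close> for some finitely generated \<open>F \<subseteq> E\<close>, and then
  \<open>(F, D)\<close> is a witness for it.
\<close>

lemma Phi_a_fixes_SStar_f_eab: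
  assumes "star \<in> SStar_f_eab"
  shows "Phi_a star = star"
proof -
  have star: "star \<in> SStar" and ft: "finite_type star" and eab: "eab star"
    using assms by (auto simp: SStar_f_eab_def)
  show ?thesis
  proof (rule extensionalityI[of _ submodules])
    fix E :: "'a fract set" assume E: "E \<in> submodules"
    show "Phi_a star E = star E"
    proof
      show "Phi_a star E \<subseteq> star E"
      proof
        fix x assume "x \<in> Phi_a star E"
        then obtain F G where FG: "F \<in> fg_ideals" "G \<in> fg_ideals" "F \<subseteq> E" "witness star F G x"
          by (auto simp: in_Phi_a_iff[OF star E])
        have sub: "F \<in> submodules" "G \<in> submodules"
          using FG fg_ideals_subset_submodules by blast+
        show "x \<in> star E"
        proof (cases "x = 0")
          case True
          then show ?thesis
            using D.subspace_0[OF SStar_subspace[OF star E]] by simp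
        next
          case False
          let ?X = "D.span {x}"
          have X: "?X \<in> fg_ideals" "?X \<in> submodules"
            using fg_ideals_principal[OF False] fg_ideals_subset_submodules by auto
          have "mod_prod G ?X \<subseteq> star (mod_prod G F)"
            using FG(4) mod_prod_principal[of G x] sub
            by (auto simp: witness_def mod_prod_commute[of G] submodulesD)
          then have "star (mod_prod G ?X) \<subseteq> star (mod_prod G F)"
            by (intro SStar_closure_subset[OF star] mod_prod_submodules sub X)
          then have "star ?X \<subseteq> star F"
            using eab FG X by (auto simp: eab_def)
          also have "\<dots> \<subseteq> star E"
            by (intro SStar_mono[OF star] sub E FG)
          finally show ?thesis
            using SStar_extensive[OF star X(2)] by (auto intro: D.span_base)
        qed
      qed
      show "star E \<subseteq> Phi_a star E"
      proof
        fix x assume "x \<in> star E"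
        then obtain F where F: "F \<in> fg_ideals" "F \<subseteq> E" "x \<in> star F"
          using ft E unfolding finite_type_def by blast
        then have "witness star F (D.span {1}) x"
          using fg_ideals_subset_submodules by (intro witness_of_mem[OF star]) auto
        then show "x \<in> Phi_a star E"
          using F fg_ideals_principal[of 1] by (auto simp: in_Phi_a_iff[OF star E])
      qed
    qed
  qed (simp_all add: Phi_a_def SStar_extensional[OF star])
qed

section \<open>Continuity\<close>

lemma openin_mem_star:
  assumes E: "E \<in> submodules"
  shows "openin SStar_zariski {star \<in> SStar. g \<in> star E}"
proof (cases "g = 0")
  case True
  then have "{star \<in> SStar. g \<in> star E} = topspace SStar_zariski"
    using D.subspace_0[OF SStar_subspace[OF _ E]] by (auto simp: topspace_SStar_zariski)
  then show ?thesis
    by simp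
next
  case False
  let ?E = "(\<lambda>x. inverse g * x) ` E"
  have "{star \<in> SStar. g \<in> star E} = {star \<in> SStar. 1 \<in> star ?E}"
    using mem_star_iff_one_mem[OF _ E False] by blast
  moreover have "?E \<in> submodules"
    using False by (intro submodules_scale E) simp
  then have "openin SStar_zariski {star \<in> SStar. 1 \<in> star ?E}"
    unfolding SStar_zariski_def by (intro topology_generated_by_Basis) blast
  ultimately show ?thesis
    by simp
qed

lemma openin_fg_subset_star:
  assumes G: "G \<in> fg_ideals" and E: "E \<in> submodules"
  shows "openin SStar_zariski {star \<in> SStar. G \<subseteq> star E}"
proof -
  obtain S where S: "finite S" "G = D.span S"
    using G by (auto simp: fg_ideals_iff)
  have "G \<subseteq> star E \<longleftrightarrow> S \<subseteq> star E" if "star \<in> SStar" for star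
    using S D.span_minimal[OF _ SStar_subspace[OF that E]] by (auto intro: D.span_base)
  then have eq: "{star \<in> SStar. G \<subseteq> star E} =
      topspace SStar_zariski \<inter> \<Inter>((\<lambda>g. {star \<in> SStar. g \<in> star E}) ` S)"
    by (auto simp: topspace_SStar_zariski)
  show ?thesis
    unfolding eq
    by (cases "S = {}") (use S in \<open>auto intro!: openin_Int openin_Inter openin_mem_star E\<close>)
qed

lemma openin_Phi_a_preimage:
  assumes E: "E \<in> submodules"
  shows "openin SStar_zariski {star \<in> SStar. 1 \<in> Phi_a star E}"
proof -
  have "{star \<in> SStar. 1 \<in> Phi_a star E} =
      (\<Union>F\<in>{F \<in> fg_ideals. F \<subseteq> E}. \<Union>G\<in>fg_ideals. {star \<in> SStar. G \<subseteq> star (mod_prod F G)})"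
    by (auto simp: in_Phi_a_iff[OF _ E] witness_def subset_iff) blast+
  moreover have "openin SStar_zariski {star \<in> SStar. G \<subseteq> star (mod_prod F G)}"
    if "F \<in> fg_ideals" "G \<in> fg_ideals" for F G :: "'a fract set"
    using that fg_ideals_subset_submodules
    by (intro openin_fg_subset_star mod_prod_submodules) auto
  ultimately show ?thesis
    by (auto intro!: openin_Union)
qed

lemma continuous_map_Phi_a: "continuous_map SStar_zariski SStar_zariski Phi_a"
proof -
  have "continuous_map SStar_zariski
    (topology_generated_by {{star \<in> SStar. 1 \<in> star E} |E :: 'a fract set. E \<in> submodules}) Phi_a"
  proof (rule continuous_on_generated_topo)
    fix U :: "('a fract set \<Rightarrow> 'a fract set) set"
    assume "U \<in> {{star \<in> SStar. 1 \<in> star E} |E. E \<in> submodules}"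
    then obtain E where E: "E \<in> submodules" "U = {star \<in> SStar. 1 \<in> star E}"
      by blast
    then have "Phi_a -` U \<inter> topspace SStar_zariski = {star \<in> SStar. 1 \<in> Phi_a star E}"
      using Phi_a_in_SStar by (auto simp: topspace_SStar_zariski)
    then show "openin SStar_zariski (Phi_a -` U \<inter> topspace SStar_zariski)"
      using openin_Phi_a_preimage[OF E(1)] by simp
  next
    have "\<Union>{{star \<in> SStar. 1 \<in> star E} |E :: 'a fract set. E \<in> submodules} = SStar"
      using topspace_SStar_zariski
      unfolding SStar_zariski_def topology_generated_by_topspace .
    then show "Phi_a ` topspace SStar_zariski
        \<subseteq> \<Union>{{star \<in> SStar. 1 \<in> star E} |E :: 'a fract set. E \<in> submodules}"
      using Phi_a_in_SStar by (auto simp: topspace_SStar_zariski)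
  qed
  then show ?thesis
    by (simp flip: SStar_zariski_def)
qed

section \<open>The retraction\<close>

theorem proposition5p2:
  shows "retraction_maps
    (SStar_zariski :: ('a :: idom fract set \<Rightarrow> 'a fract set) topology)
    (subtopology SStar_zariski SStar_f_eab) Phi_a id"
  unfolding retraction_maps_def topspace_SStar_f_eab
proof (intro conjI ballI)
  have "Phi_a star \<in> SStar_f_eab"
    if "star \<in> SStar" for star :: "'a fract set \<Rightarrow> 'a fract set"
    using that by (simp add: SStar_f_eab_def Phi_a_in_SStar finite_type_Phi_a eab_Phi_a)
  then show "continuous_map SStar_zariski
      (subtopology (SStar_zariski :: ('a fract set \<Rightarrow> 'a fract set) topology) SStar_f_eab) Phi_a"
    by (auto simp: continuous_map_in_subtopology continuous_map_Phi_a topspace_SStar_zariski)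
  show "continuous_map (subtopology SStar_zariski SStar_f_eab)
      (SStar_zariski :: ('a fract set \<Rightarrow> 'a fract set) topology) id"
    by (simp add: continuous_map_from_subtopology)
  show "Phi_a (id star) = star"
    if "star \<in> SStar_f_eab" for star :: "'a fract set \<Rightarrow> 'a fract set"
    using that by (simp add: Phi_a_fixes_SStar_f_eab)
qed

end
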